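(* Let $S$ be a finite alphabet. If $\tau : S \to S^+$ is a substitution and long symbols are syndetic in $X_\tau$, then $X_\tau$ is quasiminimal.
   Context: $S^+$ is the set of nonempty finite words over $S$; $\tau$ is extended to words by concatenation. Write $u \sqsubset v$ if $u$ is a contiguous subword of $v$ (and similarly for points or sets of points in place of $v$). A subshift is a closed (product topology) set $X \subset S^{\mathbb{Z}}$ with $\sigma(X)=X$, where $\sigma(x)_i=x_{i+1}$; it is quasiminimal if it contains only finitely many proper subshifts $Y \subsetneq X$. The subshift $X_\tau \subset S^{\mathbb{Z}}$ generated by $\tau$ is defined by: $x \in X_\tau$ if and only if for all integers $j \leq k$ there exist $a \in S$ and $\ell \in \mathbb{N}$ with $x_{[j,k]} \sqsubset \tau^\ell(a)$. The set of long symbols is $S_\ell = \{a \in S : |\tau^n(a)| \to \infty \text{ as } n \to \infty\}$. Long symbols are syndetic in $X_\tau$ if there exists $m$ such that every word $w \sqsubset X_\tau$ with $|w| \geq m$ contains a symbol of $S_\ell$. *)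

theory Defs
  imports "HOL-Analysis.Analysis" "HOL-Library.Sublist"
begin

(* The alphabet S is the universe of a type, finite where required by a sort constraint;
   words over S are lists and configurations in S^Z are functions on the integers. *)

definition shift :: "(int \<Rightarrow> 'a) \<Rightarrow> int \<Rightarrow> 'a" where
  "shift x = (\<lambda>i. x (i + 1))"

(* The empty set is a subshift. *)
definition subshift :: "(int \<Rightarrow> 'a) set \<Rightarrow> bool" where
  "subshift X \<longleftrightarrow>
     closedin (product_topology (\<lambda>_. discrete_topology UNIV) UNIV) X \<and> shift ` X = X"

definition quasiminimal :: "(int \<Rightarrow> 'a) set \<Rightarrow> bool" where
  "quasiminimal X \<longleftrightarrow> subshift X \<and> finite {Y. subshift Y \<and> Y \<subset> X}"

(* x_[j,k]; the bounds j and k are both included. *)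
definition window :: "(int \<Rightarrow> 'a) \<Rightarrow> int \<Rightarrow> int \<Rightarrow> 'a list" where
  "window x j k = map x [j..k]"

definition occurs_in :: "'a list \<Rightarrow> (int \<Rightarrow> 'a) set \<Rightarrow> bool" where
  "occurs_in w X \<longleftrightarrow> (\<exists>x\<in>X. \<exists>j k. w = window x j k)"

definition substitution :: "('a \<Rightarrow> 'a list) \<Rightarrow> bool" where
  "substitution \<tau> \<longleftrightarrow> (\<forall>a. \<tau> a \<noteq> [])"

definition extend :: "('a \<Rightarrow> 'a list) \<Rightarrow> 'a list \<Rightarrow> 'a list" where
  "extend \<tau> w = concat (map \<tau> w)"

definition iterate :: "('a \<Rightarrow> 'a list) \<Rightarrow> nat \<Rightarrow> 'a \<Rightarrow> 'a list" where
  "iterate \<tau> n a = (extend \<tau> ^^ n) [a]"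

definition substitution_subshift :: "('a \<Rightarrow> 'a list) \<Rightarrow> (int \<Rightarrow> 'a) set" where
  "substitution_subshift \<tau> =
     {x. \<forall>j k. j \<le> k \<longrightarrow> (\<exists>a l. sublist (window x j k) (iterate \<tau> l a))}"

definition long_symbols :: "('a \<Rightarrow> 'a list) \<Rightarrow> 'a set" where
  "long_symbols \<tau> = {a. filterlim (\<lambda>n. length (iterate \<tau> n a)) at_top sequentially}"

definition long_symbols_syndetic :: "('a \<Rightarrow> 'a list) \<Rightarrow> bool" where
  "long_symbols_syndetic \<tau> \<longleftrightarrow>
     (\<exists>m. \<forall>w. occurs_in w (substitution_subshift \<tau>) \<and> length w \<ge> m \<longrightarrow>
        set w \<inter> long_symbols \<tau> \<noteq> {})"

end

theory Submission
  imports Defs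
begin

text \<open>
  The languages of the subshifts \<open>Y \<subseteq> X\<^sub>\<tau>\<close> can be described at every scale by the same bounded
  amount of information. Let \<open>m\<close> be such that every word of length at least \<open>m\<close> in the language
  of \<open>X\<^sub>\<tau>\<close> contains a long symbol, and let \<open>v\<close> be a nonempty word of \<open>Y\<close> that is no longer than
  any of the words \<open>\<tau>\<^sup>n(a)\<close> with \<open>a\<close> long. Enlarge \<open>v\<close> to a big window of a point of \<open>Y\<close>; the
  window lies in some \<open>\<tau>\<^sup>l(b)\<close> with \<open>l \<ge> n\<close>, and so it is cut into blocks \<open>\<tau>\<^sup>n(c)\<close>. Apart from
  the first and the last block that meet \<open>v\<close>, the blocks that meet \<open>v\<close> lie inside \<open>v\<close> and are
  jointly shorter than \<open>v\<close>, so none of them comes from a long symbol. Short symbols produce only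
  short symbols; hence these inner blocks form a word of \<open>X\<^sub>\<tau>\<close> without long symbols, and there
  are fewer than \<open>m\<close> of them. Thus \<open>v\<close> is a subword of a word \<open>\<tau>\<^sup>n(w)\<close> that occurs in \<open>Y\<close>, with
  \<open>|w| \<le> m + 2\<close> (lemma \<open>word_covered_by_blocks\<close>).

  Therefore the set of all \<open>w\<close> with \<open>|w| \<le> m + 2\<close> for which \<open>\<tau>\<^sup>n(w)\<close> occurs in \<open>Y\<close> determines
  the words of \<open>Y\<close> up to a length that tends to infinity with \<open>n\<close>. The number of possible sets
  does not depend on \<open>n\<close>. As two distinct subshifts are told apart by some finite word (lemma
  \<open>subshift_subset_if_words_occur\<close>), a pigeonhole argument (lemma
  \<open>finite_if_eventually_separated\<close>) bounds the number of subshifts.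
\<close>

section \<open>Windows and subshifts\<close>

lemma length_window: "length (window x j k) = nat (k - j + 1)"
  by (simp add: window_def)

lemma window_append:
  assumes "j \<le> k" "k \<le> l + 1"
  shows "window x j l = window x j (k - 1) @ window x k l"
proof (cases "k \<le> l")
  case True
  then show ?thesis using assms by (simp add: window_def upto_split1[of j k l])
next
  case False
  then have "k = l + 1" using assms(2) by simp
  then show ?thesis by (simp add: window_def)
qed

lemma window_nth: "i < length (window x j k) \<Longrightarrow> window x j k ! i = x (j + int i)"
  by (auto simp: window_def)

lemma window_eqI:
  assumes "length w = nat (k - j + 1)" "\<And>i. i < length w \<Longrightarrow> w ! i = x (j + int i)"
  shows "w = window x j k"
  using assms by (intro nth_equalityI) (auto simp: length_window window_nth)

lemma occurs_in_sublist:
  assumes "occurs_in V Y" "sublist v V"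
  shows "occurs_in v Y"
proof -
  obtain x j k where x: "x \<in> Y" "V = window x j k"
    using assms(1) by (auto simp: occurs_in_def)
  obtain l r where V: "V = l @ v @ r"
    using assms(2) by (auto simp: sublist_def)
  let ?j = "j + int (length l)"
  have "v = window x ?j (?j + int (length v) - 1)"
  proof (rule window_eqI)
    fix i assume i: "i < length v"
    have "v ! i = V ! (length l + i)"
      using i by (simp add: V nth_append)
    also have "\<dots> = x (j + int (length l + i))"
      using window_nth[of "length l + i" x j k] i V x(2) by simp
    finally show "v ! i = x (?j + int i)"
      by (simp add: add.assoc)
  qed simp
  then show ?thesis
    using x(1) by (auto simp: occurs_in_def)
qed

lemma subshift_closed_under_translation:
  assumes "subshift Y" "x \<in> Y"
  shows "(\<lambda>i. x (i + d)) \<in> Y"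
proof -
  have Y: "shift ` Y = Y"
    using assms(1) by (simp add: subshift_def)
  show ?thesis
  proof (induction d rule: int_induct[where k = 0])
    case base
    then show ?case using assms(2) by simp
  next
    case (step1 d)
    then have "shift (\<lambda>i. x (i + d)) \<in> Y" using Y by blast
    then show ?case by (simp add: shift_def add.assoc add.commute[of 1])
  next
    case (step2 d)
    then obtain y where y: "y \<in> Y" "(\<lambda>i. x (i + d)) = shift y" using Y by blast
    have "y i = x (i + (d - 1))" for i
      using fun_cong[OF y(2), of "i - 1"] by (simp add: shift_def algebra_simps)
    then have "y = (\<lambda>i. x (i + (d - 1)))" by blast
    then show ?case using y(1) by simp
  qed
qed

abbreviation (input) config_topology :: "(int \<Rightarrow> 'a) topology" where
  "config_topology \<equiv> product_topology (\<lambda>_. discrete_topology UNIV) UNIV"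

lemma openin_cylinder: "openin config_topology {y. window y j k = w}"
proof (cases "length w = nat (k - j + 1)")
  case True
  have "{y. window y j k = w} = Pi\<^sub>E UNIV (\<lambda>i. if j \<le> i \<and> i \<le> k then {w ! nat (i - j)} else UNIV)"
    (is "?L = ?R")
  proof (intro set_eqI iffI)
    fix y assume "y \<in> ?L"
    then have w: "w = window y j k" by simp
    have "y i = w ! nat (i - j)" if "j \<le> i" "i \<le> k" for i
      using that window_nth[of "nat (i - j)" y j k] by (simp add: w length_window)
    then show "y \<in> ?R" by (auto simp: PiE_def)
  next
    fix y assume y: "y \<in> ?R"
    have yi: "y i = w ! nat (i - j)" if "j \<le> i" "i \<le> k" for i
      using y that by (auto simp: PiE_def Pi_def dest: spec[of _ i])
    have "w = window y j k"
      using True by (intro window_eqI) (auto simp: yi)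
    then show "y \<in> ?L" by simp
  qed
  moreover have "openin config_topology ?R"
  proof (rule product_topology_basis)
    show "finite {i. (if j \<le> i \<and> i \<le> k then {w ! nat (i - j)} else UNIV) \<noteq> topspace (discrete_topology UNIV)}"
      by (rule finite_subset[of _ "{j..k}"]) auto
  qed simp
  ultimately show ?thesis by simp
next
  case False
  then have "{y. window y j k = w} = {}" by (auto simp: length_window)
  then show ?thesis by simp
qed

lemma open_contains_cylinder:
  assumes "openin config_topology U" "x \<in> U"
  shows "\<exists>N::nat. {y. window y (- int N) (int N) = window x (- int N) (int N)} \<subseteq> U"
proof -
  obtain Z where Z: "x \<in> Pi\<^sub>E UNIV Z" "finite {i. Z i \<noteq> UNIV}" "Pi\<^sub>E UNIV Z \<subseteq> U"
    using product_topology_open_contains_basis[OF assms] by auto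
  obtain N where N: "\<And>i. i \<in> nat ` abs ` {i. Z i \<noteq> UNIV} \<Longrightarrow> i \<le> N"
    using Z(2) by (metis finite_imageI finite_nat_set_iff_bounded_le)
  have "y \<in> Pi\<^sub>E UNIV Z" if "window y (- int N) (int N) = window x (- int N) (int N)" for y
  proof -
    have "y i \<in> Z i" for i
    proof (cases "Z i = UNIV")
      case False
      then have "nat \<bar>i\<bar> \<le> N" using N by blast
      then have "i \<in> set [- int N..int N]" by auto
      then have "y i = x i" using that by (auto simp: window_def)
      then show ?thesis using Z(1) by (auto simp: PiE_def Pi_def)
    qed simp
    then show ?thesis by (auto simp: PiE_def)
  qed
  then show ?thesis using Z(3) by blast
qed

text \<open>
  Every central window of a point of \<open>Y\<close> occurs in \<open>Z\<close>, after a translation at the same place, so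
  the point is in the closure of \<open>Z\<close>. The words are restricted to nonempty ones because these are
  the words that blocks will be shown to cover.
\<close>

lemma subshift_subset_if_words_occur:
  assumes "subshift Z" and words: "\<And>v. v \<noteq> [] \<Longrightarrow> occurs_in v Y \<Longrightarrow> occurs_in v Z"
  shows "Y \<subseteq> Z"
proof (rule subsetI, rule ccontr)
  fix x assume x: "x \<in> Y" "x \<notin> Z"
  have "openin config_topology (- Z)"
    using assms(1) by (simp add: subshift_def closedin_def Compl_eq_Diff_UNIV)
  with x(2) obtain N :: nat
    where N: "{y. window y (- int N) (int N) = window x (- int N) (int N)} \<subseteq> - Z"
    using open_contains_cylinder[of "- Z" x] by auto
  let ?v = "window x (- int N) (int N)"
  have len: "length ?v = 2 * N + 1" by (simp add: length_window)
  then have "?v \<noteq> []" by auto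
  moreover have "occurs_in ?v Y" using x(1) by (auto simp: occurs_in_def)
  ultimately have "occurs_in ?v Z" by (rule words)
  then obtain y j k where y: "y \<in> Z" "?v = window y j k"
    unfolding occurs_in_def by blast
  let ?y = "\<lambda>i. y (i + (j + int N))"
  have "?v = window ?y (- int N) (int N)"
  proof (rule window_eqI)
    fix i assume "i < length ?v"
    then show "?v ! i = y (- int N + int i + (j + int N))"
      using y(2) by (simp add: window_nth algebra_simps)
  qed (simp add: length_window)
  moreover have "?y \<in> Z"
    using subshift_closed_under_translation[OF assms(1) y(1)] .
  ultimately show False using N by auto
qed

lemma shift_image_translation_closed:
  assumes "\<And>x d. x \<in> X \<Longrightarrow> (\<lambda>i. x (i + d)) \<in> X"
  shows "shift ` X = X"
proof (intro subset_antisym subsetI)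
  fix x assume "x \<in> X"
  then have "shift (\<lambda>i. x (i + (- 1))) \<in> shift ` X" using assms by blast
  then show "x \<in> shift ` X" by (simp add: shift_def)
qed (use assms[of _ 1] in \<open>auto simp: shift_def\<close>)

lemma subshift_substitution_subshift: "subshift (substitution_subshift \<tau>)"
  (is "subshift ?X")
proof -
  have "(\<lambda>i. x (i + d)) \<in> ?X" if "x \<in> ?X" for x d
  proof -
    have "window (\<lambda>i. x (i + d)) j k = window x (j + d) (k + d)" for j k
      by (rule window_eqI) (auto simp: length_window window_nth algebra_simps)
    then show ?thesis using that by (auto simp: substitution_subshift_def)
  qed
  then have "shift ` ?X = ?X" by (rule shift_image_translation_closed)
  moreover have "openin config_topology (- ?X)"
  proof (subst openin_subopen, intro ballI)
    fix x assume "x \<in> - ?X"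
    then obtain j k where jk: "j \<le> k" "\<nexists>a l. sublist (window x j k) (iterate \<tau> l a)"
      by (auto simp: substitution_subshift_def)
    have "y \<notin> ?X" if y: "window y j k = window x j k" for y
    proof
      assume "y \<in> ?X"
      then have "\<exists>a l. sublist (window y j k) (iterate \<tau> l a)"
        using jk(1) unfolding substitution_subshift_def by blast
      then show False using jk(2) y by simp
    qed
    then have "{y. window y j k = window x j k} \<subseteq> - ?X" by blast
    then show "\<exists>T. openin config_topology T \<and> x \<in> T \<and> T \<subseteq> - ?X"
      using openin_cylinder[of j k "window x j k"] by blast
  qed
  ultimately show ?thesis
    by (simp add: subshift_def closedin_def Compl_eq_Diff_UNIV)
qed

section \<open>Iterates of a substitution\<close>

lemma extend_simps [simp]:
  "extend f [] = []" "extend f (a # w) = f a @ extend f w"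
  "extend f (u @ w) = extend f u @ extend f w"
  by (simp_all add: extend_def)

lemma funpow_extend: "(extend \<tau> ^^ n) w = extend (iterate \<tau> n) w"
proof -
  have append: "(extend \<tau> ^^ n) (u @ v) = (extend \<tau> ^^ n) u @ (extend \<tau> ^^ n) v" for u v
    by (induction n) auto
  moreover have "(extend \<tau> ^^ n) [] = []"
    by (induction n) auto
  ultimately show ?thesis
  proof (induction w)
    case (Cons a w)
    then show ?case
      using append[of "[a]" w] by (simp add: iterate_def)
  qed simp
qed

lemma iterate_add: "iterate \<tau> (n + l) a = extend (iterate \<tau> n) (iterate \<tau> l a)"
  by (simp add: iterate_def funpow_add flip: funpow_extend)

lemma length_extend_ge:
  assumes "\<And>a. f a \<noteq> []"
  shows "length w \<le> length (extend f w)"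
proof (induction w)
  case (Cons a w)
  then show ?case using assms[of a] by (cases "f a") auto
qed simp

lemma iterate_nonempty: "substitution \<tau> \<Longrightarrow> iterate \<tau> n a \<noteq> []"
proof (induction n)
  case (Suc n)
  have "length (iterate \<tau> n a) \<le> length (extend \<tau> (iterate \<tau> n a))"
    using Suc.prems by (intro length_extend_ge) (auto simp: substitution_def)
  then show ?case using Suc by (auto simp: iterate_def)
qed (simp add: iterate_def)

lemma length_iterate_mono:
  assumes "substitution \<tau>" "l \<le> n"
  shows "length (iterate \<tau> l a) \<le> length (iterate \<tau> n a)"
  using length_extend_ge[of "iterate \<tau> (n - l)" "iterate \<tau> l a"] iterate_nonempty[OF assms(1)]
    iterate_add[of \<tau> "n - l" l a] assms(2) by simp

lemma length_le_extend: "c \<in> set w \<Longrightarrow> length (f c) \<le> length (extend f w)"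
  by (induction w) auto

text \<open>A symbol with a long descendant grows at least as fast as that descendant.\<close>

lemma long_if_descendant_long:
  assumes "c \<in> set (iterate \<tau> n b)" "c \<in> long_symbols \<tau>"
  shows "b \<in> long_symbols \<tau>"
proof -
  have "length (iterate \<tau> k c) \<le> length (iterate \<tau> (k + n) b)" for k
    using length_le_extend[OF assms(1)] by (simp add: iterate_add)
  then have "filterlim (\<lambda>k. length (iterate \<tau> (k + n) b)) at_top sequentially"
    using assms(2) by (auto simp: long_symbols_def intro: filterlim_at_top_mono)
  then have "eventually (\<lambda>k. Z \<le> length (iterate \<tau> k b)) sequentially" for Z
    using eventually_sequentially_seg[of "\<lambda>k. Z \<le> length (iterate \<tau> k b)" n]
    by (simp add: filterlim_at_top)
  then show ?thesis
    by (simp add: long_symbols_def filterlim_at_top)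
qed

lemma extend_iterate_short:
  assumes "set q \<inter> long_symbols \<tau> = {}"
  shows "set (extend (iterate \<tau> n) q) \<inter> long_symbols \<tau> = {}"
  using assms long_if_descendant_long[of _ \<tau> n] by (fastforce simp: extend_def)

section \<open>Cutting words into blocks\<close>

lemma append_eq_append_cases:
  assumes "u @ v = x @ y"
  obtains (longer) us where "u = x @ us" "us \<noteq> []" "y = us @ v"
    | (shorter) us where "x = u @ us" "v = us @ y"
proof -
  obtain us where "u = x @ us \<and> us @ v = y \<or> u @ us = x \<and> v = us @ y"
    using assms by (auto simp: append_eq_append_conv2)
  then show thesis
    using that by (cases "us = []") auto
qed

text \<open>
  A cut of \<open>extend f w\<close> falls into a block or between two blocks. In the latter case the first
  lemma selects the block after the cut and the second one the block before it. Applied to the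
  left and to the right end of a subword, they select blocks that share a letter with it.
\<close>

lemma extend_split_right:
  assumes "extend f w = A @ C" "C \<noteq> []"
  shows "\<exists>p a s \<alpha> \<beta>. w = p @ a # s \<and> f a = \<alpha> @ \<beta> \<and> \<beta> \<noteq> [] \<and> A = extend f p @ \<alpha> \<and> C = \<beta> @ extend f s"
  using assms
proof (induction w arbitrary: A)
  case (Cons a w)
  from Cons.prems(1) consider \<beta> where "f a = A @ \<beta>" "\<beta> \<noteq> []" "C = \<beta> @ extend f w"
    | A' where "A = f a @ A'" "extend f w = A' @ C"
    using append_eq_append_cases[of "f a" "extend f w" A C] by auto
  then show ?case
  proof cases
    case 1
    then have "a # w = [] @ a # w \<and> f a = A @ \<beta> \<and> \<beta> \<noteq> [] \<and> A = extend f [] @ A \<and> C = \<beta> @ extend f w"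
      by simp
    then show ?thesis by blast
  next
    case 2
    from Cons.IH[OF 2(2) Cons.prems(2)] obtain p b s \<alpha> \<beta> where
      "w = p @ b # s \<and> f b = \<alpha> @ \<beta> \<and> \<beta> \<noteq> [] \<and> A' = extend f p @ \<alpha> \<and> C = \<beta> @ extend f s"
      by blast
    then have "a # w = (a # p) @ b # s \<and> f b = \<alpha> @ \<beta> \<and> \<beta> \<noteq> [] \<and> A = extend f (a # p) @ \<alpha>
      \<and> C = \<beta> @ extend f s"
      using 2(1) by simp
    then show ?thesis by blast
  qed
qed simp

lemma extend_split_left:
  assumes "extend f w = A @ C" "A \<noteq> []"
  shows "\<exists>p a s \<alpha> \<beta>. w = p @ a # s \<and> f a = \<alpha> @ \<beta> \<and> \<alpha> \<noteq> [] \<and> A = extend f p @ \<alpha> \<and> C = \<beta> @ extend f s"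
  using assms
proof (induction w arbitrary: A)
  case (Cons a w)
  from Cons.prems(1) consider \<beta> where "f a = A @ \<beta>" "C = \<beta> @ extend f w"
    | A' where "A = f a @ A'" "A' \<noteq> []" "extend f w = A' @ C"
    using append_eq_append_cases[of A C "f a" "extend f w"] by auto
  then show ?case
  proof cases
    case 1
    then have "a # w = [] @ a # w \<and> f a = A @ \<beta> \<and> A \<noteq> [] \<and> A = extend f [] @ A \<and> C = \<beta> @ extend f w"
      using Cons.prems(2) by simp
    then show ?thesis by blast
  next
    case 2
    from Cons.IH[OF 2(3,2)] obtain p b s \<alpha> \<beta> where
      "w = p @ b # s \<and> f b = \<alpha> @ \<beta> \<and> \<alpha> \<noteq> [] \<and> A' = extend f p @ \<alpha> \<and> C = \<beta> @ extend f s"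
      by blast
    then have "a # w = (a # p) @ b # s \<and> f b = \<alpha> @ \<beta> \<and> \<alpha> \<noteq> [] \<and> A = extend f (a # p) @ \<alpha>
      \<and> C = \<beta> @ extend f s"
      using 2(1) by simp
    then show ?thesis by blast
  qed
qed simp

text \<open>
  Here \<open>u\<close> lists the symbols whose blocks cover the given occurrence of \<open>v\<close>, and \<open>q\<close> the inner ones
  among them; \<open>q\<close> is empty if \<open>v\<close> lies in a single block. Otherwise the two outer blocks contribute
  at least one letter each to \<open>v\<close>, which makes the length bound on \<open>extend f q\<close> strict. The outer
  blocks stick out of \<open>v\<close> by at most a block length.
\<close>

lemma minimal_block_cover:
  assumes "extend f w = A @ v @ C" "v \<noteq> []" and B: "\<And>a. length (f a) \<le> B"
  shows "\<exists>u q A' \<alpha> \<gamma> C'. A = A' @ \<alpha> \<and> C = \<gamma> @ C' \<and> extend f u = \<alpha> @ v @ \<gamma> \<and>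
    length \<alpha> \<le> B \<and> length \<gamma> \<le> B \<and> length u \<le> length q + 2 \<and>
    sublist (extend f q) v \<and> length (extend f q) < length v"
proof -
  obtain p a s \<alpha> \<beta> where first: "w = p @ a # s" "f a = \<alpha> @ \<beta>" "\<beta> \<noteq> []" "A = extend f p @ \<alpha>"
    "v @ C = \<beta> @ extend f s"
    using extend_split_right[OF assms(1)] assms(2) by auto
  have \<alpha>: "length \<alpha> \<le> B" using B[of a] first(2) by simp
  from first(5) consider \<gamma> where "\<beta> = v @ \<gamma>" "C = \<gamma> @ extend f s"
    | v' where "v = \<beta> @ v'" "v' \<noteq> []" "extend f s = v' @ C"
    using append_eq_append_cases[of v C \<beta> "extend f s"] by auto
  then show ?thesis
  proof cases
    case 1
    have "length \<gamma> \<le> B" using B[of a] first(2) 1(1) by simp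
    then have "A = extend f p @ \<alpha> \<and> C = \<gamma> @ extend f s \<and> extend f [a] = \<alpha> @ v @ \<gamma> \<and>
        length \<alpha> \<le> B \<and> length \<gamma> \<le> B \<and> length [a] \<le> length [] + 2 \<and>
        sublist (extend f []) v \<and> length (extend f []) < length v"
      using 1 \<alpha> first(2) first(4) assms(2) by simp
    then show ?thesis by blast
  next
    case 2
    obtain q b t \<gamma>' \<gamma> where last: "s = q @ b # t" "f b = \<gamma>' @ \<gamma>" "\<gamma>' \<noteq> []"
      "v' = extend f q @ \<gamma>'" "C = \<gamma> @ extend f t"
      using extend_split_left[OF 2(3,2)] by auto
    have "length \<gamma> \<le> B" using B[of b] last(2) by simp
    moreover have "v = \<beta> @ extend f q @ \<gamma>'" using 2(1) last(4) by simp
    moreover have "sublist (extend f q) v"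
      unfolding calculation(2) by (rule sublist_appendI)
    ultimately have "A = extend f p @ \<alpha> \<and> C = \<gamma> @ extend f t \<and> extend f (a # q @ [b]) = \<alpha> @ v @ \<gamma> \<and>
        length \<alpha> \<le> B \<and> length \<gamma> \<le> B \<and> length (a # q @ [b]) \<le> length q + 2 \<and>
        sublist (extend f q) v \<and> length (extend f q) < length v"
      using last(2,3,5) \<alpha> first(2,3,4) by simp
    then show ?thesis by blast
  qed
qed

text \<open>
  The inner blocks are jointly shorter than \<open>v\<close>, so they come from short symbols. Their
  concatenation is then a word of the substitution subshift without long symbols. It has length
  less than \<open>m\<close>, and so it consists of fewer than \<open>m\<close> blocks, for every \<open>n\<close>.
\<close>

lemma word_covered_by_blocks:
  fixes \<tau> :: "'a::finite \<Rightarrow> 'a list"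
  assumes \<tau>: "substitution \<tau>"
    and m: "\<And>w. occurs_in w (substitution_subshift \<tau>) \<Longrightarrow> length w \<ge> m \<Longrightarrow>
      set w \<inter> long_symbols \<tau> \<noteq> {}"
    and Y: "Y \<subseteq> substitution_subshift \<tau>"
    and v: "occurs_in v Y" "v \<noteq> []"
    and n: "\<And>a. a \<in> long_symbols \<tau> \<Longrightarrow> length v \<le> length (iterate \<tau> n a)"
  shows "\<exists>u. length u \<le> m + 2 \<and> sublist v (extend (iterate \<tau> n) u) \<and>
    occurs_in (extend (iterate \<tau> n) u) Y"
proof -
  let ?f = "iterate \<tau> n"
  define B where "B = Max (range (\<lambda>a. length (?f a)))"
  have B: "length (?f a) \<le> B" for a
    unfolding B_def by (rule Max_ge) auto
  obtain x j k where x: "x \<in> Y" "v = window x j k"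
    using v(1) by (auto simp: occurs_in_def)
  have jk: "j \<le> k" using v(2) x(2) by (auto simp: window_def)
  \<comment> \<open>A margin of one block length on either side has room for the outer blocks that meet \<open>v\<close>, so
    the cover of \<open>v\<close> by blocks occurs in \<open>Y\<close>, too.\<close>
  define L R where "L = window x (j - int B) (j - 1)" and "R = window x (k + 1) (k + int B)"
  have len: "length L = B" "length R = B"
    by (simp_all add: L_def R_def length_window)
  have V: "window x (j - int B) (k + int B) = L @ v @ R"
    using window_append[of "j - int B" j "k + int B" x] window_append[of j "k + 1" "k + int B" x] jk
    by (simp add: L_def R_def x(2))
  have "x \<in> substitution_subshift \<tau>" "j - int B \<le> k + int B"
    using x(1) Y jk by auto
  then obtain b l where bl: "sublist (L @ v @ R) (iterate \<tau> l b)"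
    unfolding V[symmetric] substitution_subshift_def by blast
  \<comment> \<open>Lengths of iterates do not decrease, so a word of length more than \<open>B\<close> needs at least \<open>n\<close>
    iterations.\<close>
  have "n \<le> l"
  proof (rule ccontr)
    assume "\<not> n \<le> l"
    then have "length (iterate \<tau> l b) \<le> B"
      using length_iterate_mono[OF \<tau>, of l n b] B[of b] by simp
    moreover have "length (L @ v @ R) > B"
      using len v(2) by simp
    ultimately show False
      using sublist_length_le[OF bl] by simp
  qed
  then have "iterate \<tau> l b = extend ?f (iterate \<tau> (l - n) b)"
    using iterate_add[of \<tau> n "l - n" b] by simp
  with bl obtain P Q where "extend ?f (iterate \<tau> (l - n) b) = (P @ L) @ v @ (R @ Q)"
    by (auto simp: sublist_def)
  from minimal_block_cover[OF this v(2) B] obtain u q A' \<alpha> \<gamma> C' where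
    A: "P @ L = A' @ \<alpha>" and C: "R @ Q = \<gamma> @ C'" and u: "extend ?f u = \<alpha> @ v @ \<gamma>"
    and short: "length \<alpha> \<le> B" "length \<gamma> \<le> B" and uq: "length u \<le> length q + 2"
    and q: "sublist (extend ?f q) v" "length (extend ?f q) < length v"
    by blast
  have "suffix \<alpha> (P @ L)"
    unfolding A by (rule suffixI) simp
  then have "suffix \<alpha> L"
    using suffix_length_suffix[of \<alpha> "P @ L" L] short(1) len(1) by (simp add: suffix_def)
  then obtain L' where L': "L = L' @ \<alpha>" by (auto simp: suffix_def)
  have "prefix \<gamma> (R @ Q)"
    unfolding C by (rule prefixI) simp
  then have "prefix \<gamma> R"
    using prefix_length_prefix[of \<gamma> "R @ Q" R] short(2) len(2) by simp
  then obtain R' where R': "R = \<gamma> @ R'" by (auto simp: prefix_def)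
  have "sublist (extend ?f u) (L @ v @ R)"
    using sublist_appendI[of "extend ?f u" L' R'] by (simp add: u L' R')
  moreover have "occurs_in (L @ v @ R) Y"
    using x(1) V by (metis occurs_in_def)
  ultimately have occ: "occurs_in (extend ?f u) Y"
    using occurs_in_sublist by blast
  have "set q \<inter> long_symbols \<tau> = {}"
  proof (rule ccontr)
    assume "set q \<inter> long_symbols \<tau> \<noteq> {}"
    then obtain a where "a \<in> set q" "a \<in> long_symbols \<tau>" by blast
    then show False
      using n[of a] length_le_extend[of a q ?f] q(2) by simp
  qed
  then have "set (extend ?f q) \<inter> long_symbols \<tau> = {}"
    by (rule extend_iterate_short)
  moreover have "occurs_in (extend ?f q) (substitution_subshift \<tau>)"
    using occurs_in_sublist[OF v(1) q(1)] Y by (auto simp: occurs_in_def)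
  ultimately have "length (extend ?f q) < m"
    using m[of "extend ?f q"] by linarith
  then have "length q < m"
    using length_extend_ge[of ?f q] iterate_nonempty[OF \<tau>] by (simp add: order_le_less_trans)
  then have "length u \<le> m + 2" using uq by simp
  moreover have "sublist v (extend ?f u)"
    unfolding u by (rule sublist_appendI)
  ultimately show ?thesis using occ by blast
qed

section \<open>Finitely many subshifts\<close>

text \<open>
  If \<open>F\<close> were infinite, some single stage \<open>n\<close> would separate \<open>card W + 1\<close> elements of \<open>F\<close>, since
  these form only finitely many pairs.
\<close>

lemma finite_if_eventually_separated:
  assumes W: "finite W" and D: "\<And>(n::nat) y. y \<in> F \<Longrightarrow> D n y \<in> W"
    and sep: "\<And>y z. y \<in> F \<Longrightarrow> z \<in> F \<Longrightarrow> y \<noteq> z \<Longrightarrow> eventually (\<lambda>n. D n y \<noteq> D n z) sequentially"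
  shows "finite F"
proof (rule ccontr)
  assume "infinite F"
  then obtain G where G: "G \<subseteq> F" "finite G" "card G = Suc (card W)"
    using infinite_arbitrarily_large by blast
  have "eventually (\<lambda>n. \<forall>y\<in>G. \<forall>z\<in>G. y \<noteq> z \<longrightarrow> D n y \<noteq> D n z) sequentially"
    using G(1,2) sep by (intro eventually_ball_finite ballI) (auto simp: subset_iff)
  then obtain n where "\<forall>y\<in>G. \<forall>z\<in>G. y \<noteq> z \<longrightarrow> D n y \<noteq> D n z"
    using eventually_happens by fastforce
  then have "inj_on (D n) G" by (auto simp: inj_on_def)
  moreover have "D n ` G \<subseteq> W" using D G(1) by blast
  ultimately have "card G \<le> card W" using W card_inj_on_le by blast
  then show False using G(3) by simp
qed

lemma eventually_long_iterates:
  fixes \<tau> :: "'a::finite \<Rightarrow> 'a list"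
  shows "eventually (\<lambda>n. \<forall>a\<in>long_symbols \<tau>. N \<le> length (iterate \<tau> n a)) sequentially"
  by (intro eventually_ball_finite) (auto simp: long_symbols_def filterlim_at_top)

theorem proposition2:
  fixes \<tau> :: "'a::finite \<Rightarrow> 'a list"
  assumes "substitution \<tau>"
    and "long_symbols_syndetic \<tau>"
  shows "quasiminimal (substitution_subshift \<tau>)"
proof -
  let ?X = "substitution_subshift \<tau>"
  obtain m where m: "\<And>w. occurs_in w ?X \<Longrightarrow> length w \<ge> m \<Longrightarrow> set w \<inter> long_symbols \<tau> \<noteq> {}"
    using assms(2) by (auto simp: long_symbols_syndetic_def)
  \<comment> \<open>\<open>D n Y\<close> is the bounded description of \<open>Y\<close> at scale \<open>n\<close>; the set \<open>W\<close> of candidates is the same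
    at all scales.\<close>
  define W where "W = {u :: 'a list. length u \<le> m + 2}"
  define D where "D n Y = {u \<in> W. occurs_in (extend (iterate \<tau> n) u) Y}" for n Y
  have "finite W"
    using finite_lists_length_le[of "UNIV :: 'a set" "m + 2"] by (simp add: W_def)
  have separated: "eventually (\<lambda>n. D n Y \<noteq> D n Z) sequentially"
    if YZ: "Y \<subseteq> ?X" "v \<noteq> []" "occurs_in v Y" "\<not> occurs_in v Z" for Y Z v
    using eventually_long_iterates[of \<tau> "length v"]
  proof (rule eventually_mono)
    fix n assume "\<forall>a\<in>long_symbols \<tau>. length v \<le> length (iterate \<tau> n a)"
    then obtain u where "u \<in> D n Y" "sublist v (extend (iterate \<tau> n) u)"
      using word_covered_by_blocks[of \<tau> m Y v n] assms(1) m YZ unfolding D_def W_def by blast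
    moreover from this have "u \<notin> D n Z"
      using YZ(4) occurs_in_sublist[of _ Z v] by (auto simp: D_def)
    ultimately show "D n Y \<noteq> D n Z" by blast
  qed
  have "finite {Y. subshift Y \<and> Y \<subset> ?X}"
  proof (rule finite_if_eventually_separated[where W = "Pow W" and D = D])
    fix Y Z assume YZ: "Y \<in> {Y. subshift Y \<and> Y \<subset> ?X}" "Z \<in> {Y. subshift Y \<and> Y \<subset> ?X}" "Y \<noteq> Z"
    then have "\<not> Y \<subseteq> Z \<or> \<not> Z \<subseteq> Y" by blast
    then obtain v where "v \<noteq> []"
      "occurs_in v Y \<and> \<not> occurs_in v Z \<or> occurs_in v Z \<and> \<not> occurs_in v Y"
      using YZ subshift_subset_if_words_occur by (metis mem_Collect_eq)
    then show "eventually (\<lambda>n. D n Y \<noteq> D n Z) sequentially"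
      using separated[of Y v Z] separated[of Z v Y] YZ by (auto simp: eq_commute[of "D _ Z"])
  qed (use \<open>finite W\<close> in \<open>auto simp: D_def\<close>)
  then show ?thesis
    using subshift_substitution_subshift by (simp add: quasiminimal_def)
qed

end
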